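(* Let $k$ be a field of characteristic zero. The following simplicial complexes (having no facet of cardinality one) are levelable: (i) any pure simplicial complex; (ii) any simplicial complex on $n\leq 4$ vertices; (iii) any simplicial complex $\Delta$ with pairwise disjoint facets.
   Context: A simplicial complex $\Delta$ on $V=\{x_1,\ldots,x_n\}$ ($n\ge1$) is a collection of subsets of $V$ (faces) closed under taking subsets and with $\{x_i\}\in\Delta$ for all $i$; its facets are its faces that are maximal under inclusion. $\Delta$ is pure if all its facets have the same cardinality. Let $R=k[x_1,\ldots,x_n]$ with $\deg x_i=1$. The Stanley-Reisner ideal is $I_\Delta=(x_{i_1}\cdots x_{i_s} \mid \{x_{i_1},\ldots,x_{i_s}\}\notin\Delta)\subseteq R$ (squarefree monomials). For integers $a_i\ge 2$, set $A(\Delta,a_1,\ldots,a_n)=R/(I_\Delta+(x_1^{a_1},\ldots,x_n^{a_n}))$, a graded artinian algebra. For a graded artinian algebra $A=R/I$, $\operatorname{soc}(A)=\{a\in A\mid a\overline{x}_i=0 \text{ for all } i\}$, and the socle-vector is $s(A)=(s_0,\ldots,s_e)$ with $s_i=\dim_k \operatorname{soc}(A)_i$, where $e$ is the largest index with $A_e\neq 0$. $A$ is level if $s_i=0$ for all $i\neq e$. $\Delta$ is levelable if there exists a tuple $(a_1,\ldots,a_n)$ of integers, each $a_i\ge 2$, such that $A(\Delta,a_1,\ldots,a_n)$ is level. *)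

theory Defs
  imports "HOL-Library.Poly_Mapping" "HOL-Library.Cardinality" "HOL-Algebra.Algebraic_Closure_Type"
begin

text \<open>
  The vertex set \<open>V = {x\<^sub>1, \<dots>, x\<^sub>n}\<close> is the universe of a finite type \<open>'v\<close>, so \<open>n = CARD('v) \<ge> 1\<close>.
\<close>

definition simplicial_complex :: "'v set set \<Rightarrow> bool" where
  "simplicial_complex \<Delta> \<longleftrightarrow> (\<forall>F\<in>\<Delta>. \<forall>G. G \<subseteq> F \<longrightarrow> G \<in> \<Delta>) \<and> (\<forall>i. {i} \<in> \<Delta>)"

definition facets :: "'v set set \<Rightarrow> 'v set set" where
  "facets \<Delta> = {F \<in> \<Delta>. \<forall>G\<in>\<Delta>. F \<subseteq> G \<longrightarrow> G = F}"

definition pure :: "'v set set \<Rightarrow> bool" where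
  "pure \<Delta> \<longleftrightarrow> (\<forall>F\<in>facets \<Delta>. \<forall>G\<in>facets \<Delta>. card F = card G)"

text \<open>
  Polynomials in the variables indexed by \<open>'v\<close> are finitely supported maps from monomials
  (exponent vectors \<open>'v \<Rightarrow>\<^sub>0 nat\<close>) to coefficients; multiplication is convolution.
\<close>

type_synonym ('v, 'k) mpoly = "('v \<Rightarrow>\<^sub>0 nat) \<Rightarrow>\<^sub>0 'k"

abbreviation poly_ring :: "('v, 'k::field) mpoly ring" where
  "poly_ring \<equiv> ring_of_type_algebra"

definition var :: "'v \<Rightarrow> ('v, 'k::field) mpoly" where
  "var i = Poly_Mapping.single (Poly_Mapping.single i 1) 1"

definition const :: "'k \<Rightarrow> ('v, 'k::field) mpoly" where
  "const c = Poly_Mapping.single 0 c"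

definition homogeneous_polys :: "nat \<Rightarrow> ('v::finite, 'k::field) mpoly set" where
  "homogeneous_polys d =
     {f. \<forall>m\<in>Poly_Mapping.keys f. (\<Sum>i\<in>UNIV. Poly_Mapping.lookup m i) = d}"

text \<open>
  The following notions concern the algebra \<open>A = R/I\<close> for an ideal \<open>I\<close> of \<open>R = poly_ring\<close>. They are
  meant for proper homogeneous ideals \<open>I\<close> with \<open>A\<close> artinian. The elements of \<open>A\<close> are cosets of \<open>I\<close>.
\<close>

definition residue_class :: "('v, 'k::field) mpoly set \<Rightarrow> ('v, 'k) mpoly \<Rightarrow> ('v, 'k) mpoly set" where
  "residue_class I f = I +>\<^bsub>poly_ring\<^esub> f"

definition quotient_algebra :: "('v, 'k::field) mpoly set \<Rightarrow> ('v, 'k) mpoly set ring" where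
  "quotient_algebra I = poly_ring Quot I"

definition graded_part :: "('v::finite, 'k::field) mpoly set \<Rightarrow> nat \<Rightarrow> ('v, 'k) mpoly set set" where
  "graded_part I d = residue_class I ` homogeneous_polys d"

definition socle :: "('v, 'k::field) mpoly set \<Rightarrow> ('v, 'k) mpoly set set" where
  "socle I = {a \<in> carrier (quotient_algebra I).
     \<forall>i. a \<otimes>\<^bsub>quotient_algebra I\<^esub> residue_class I (var i) = \<zero>\<^bsub>quotient_algebra I\<^esub>}"

text \<open>
  Dimension over \<open>k\<close> is dimension over the image of \<open>k\<close> in \<open>A\<close>, which for proper \<open>I\<close> is a subfield of
  \<open>A\<close> isomorphic to \<open>k\<close>.
\<close>

definition scalars :: "('v, 'k::field) mpoly set \<Rightarrow> ('v, 'k) mpoly set set" where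
  "scalars I = residue_class I ` range const"

definition socle_vector :: "('v::finite, 'k::field) mpoly set \<Rightarrow> nat \<Rightarrow> nat" where
  "socle_vector I d = ring.dim (quotient_algebra I) (scalars I) (socle I \<inter> graded_part I d)"

text \<open>The maximum exists when \<open>A\<close> is nonzero and artinian.\<close>

definition socle_degree :: "('v::finite, 'k::field) mpoly set \<Rightarrow> nat" where
  "socle_degree I = Max {d. graded_part I d \<noteq> {\<zero>\<^bsub>quotient_algebra I\<^esub>}}"

definition level :: "('v::finite, 'k::field) mpoly set \<Rightarrow> bool" where
  "level I \<longleftrightarrow> (\<forall>d. d \<noteq> socle_degree I \<longrightarrow> socle_vector I d = 0)"

definition stanley_reisner_ideal :: "'v set set \<Rightarrow> ('v, 'k::field) mpoly set" where
  "stanley_reisner_ideal \<Delta> = Idl\<^bsub>poly_ring\<^esub> {\<Prod>i\<in>S. var i |S. S \<notin> \<Delta>}"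

text \<open>The ideal defining \<open>A(\<Delta>, a\<^sub>1, \<dots>, a\<^sub>n)\<close>.\<close>

definition artinian_ideal :: "'v set set \<Rightarrow> ('v \<Rightarrow> nat) \<Rightarrow> ('v, 'k::field) mpoly set" where
  "artinian_ideal \<Delta> a =
     stanley_reisner_ideal \<Delta> <+>\<^bsub>poly_ring\<^esub> Idl\<^bsub>poly_ring\<^esub> {var i ^ a i |i. True}"

text \<open>Levelability a priori depends on the field \<open>k\<close>, which is passed as a type.\<close>

definition levelable :: "'k::field itself \<Rightarrow> 'v::finite set set \<Rightarrow> bool" where
  "levelable (_ :: 'k itself) \<Delta> \<longleftrightarrow>
     (\<exists>a :: 'v \<Rightarrow> nat. (\<forall>i. a i \<ge> 2) \<and> level (artinian_ideal \<Delta> a :: ('v, 'k) mpoly set))"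

end

theory Submission
  imports Defs
begin

text \<open>
  Since \<open>I = I\<^sub>\<Delta> + (x\<^sub>i\<^bsup>a i\<^esup>)\<close> is a monomial ideal, the socle of \<open>A = R/I\<close> is spanned by monomials. A
  monomial outside \<open>I\<close> is killed by all variables iff its support is a facet \<open>F\<close> and its exponent is
  \<open>a i - 1\<close> at every \<open>i \<in> F\<close>. Hence \<open>A\<close> is level as soon as \<open>\<Sum>i\<in>F. (a i - 1)\<close> takes the same
  value on all facets, and it suffices to find positive vertex weights \<open>b i = a i - 1\<close> for which all
  facets have equal weight. Constant weights serve pure complexes, and weights inversely
  proportional to the cardinality of the facet serve disjoint facets. On \<open>n \<le> 4\<close> vertices, either \<open>V\<close>
  is the only facet or all facets have \<open>n - 1\<close> or \<open>n - 2\<close> elements; then giving weight 2 to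
  the vertices \<open>v\<close> with \<open>V - {v}\<close> a facet, and weight 1 to the others, makes up for the difference.
\<close>

section \<open>Monomial ideals\<close>

lemma poly_ring_simps [simp]:
  "carrier poly_ring = UNIV" "x \<otimes>\<^bsub>poly_ring\<^esub> y = x * y" "x \<oplus>\<^bsub>poly_ring\<^esub> y = x + y"
  "\<one>\<^bsub>poly_ring\<^esub> = 1" "\<zero>\<^bsub>poly_ring\<^esub> = 0"
  by (simp_all add: ring_of_type_algebra_def)

lemma ring_poly_ring: "ring (poly_ring :: ('v, 'k::field) mpoly ring)"
  by (rule ring_from_type_algebra)

lemma a_inv_poly_ring: "\<ominus>\<^bsub>poly_ring\<^esub> (f :: ('v, 'k::field) mpoly) = - f"
proof -
  interpret ring "poly_ring :: ('v, 'k) mpoly ring" by (rule ring_poly_ring)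
  show ?thesis by (rule minus_equality) auto
qed

lemma poly_mapping_sum_single:
  "f = (\<Sum>m\<in>Poly_Mapping.keys f. Poly_Mapping.single m (Poly_Mapping.lookup f m))"
  by (rule poly_mapping_eqI) (simp add: lookup_sum lookup_single when_def in_keys_iff)

text \<open>Shifting exponents by \<open>n\<close> is injective, so multiplying by a monomial causes
  no cancellation. This later carries each monomial of \<open>f\<close> to one of
  \<open>f * var i\<close>.\<close>

lemma lookup_times_single:
  fixes f :: "('v, 'k::field) mpoly"
  shows "Poly_Mapping.lookup (f * Poly_Mapping.single n 1) (m + n) = Poly_Mapping.lookup f m"
proof -
  have "f * Poly_Mapping.single n 1 =
      (\<Sum>l\<in>Poly_Mapping.keys f. Poly_Mapping.single (l + n) (Poly_Mapping.lookup f l))"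
    by (subst poly_mapping_sum_single[of f]) (simp add: sum_distrib_right mult_single)
  then show ?thesis
    by (simp add: lookup_sum lookup_single when_def in_keys_iff)
qed

lemma prod_var:
  "finite S \<Longrightarrow> (\<Prod>i\<in>S. var i :: ('v, 'k::field) mpoly) =
    Poly_Mapping.single (\<Sum>i\<in>S. Poly_Mapping.single i 1) 1"
  by (induction S rule: finite_induct) (simp_all add: var_def mult_single)

lemma var_power:
  "(var i :: ('v, 'k::field) mpoly) ^ n = Poly_Mapping.single (Poly_Mapping.single i n) 1"
  by (induction n) (simp_all add: var_def mult_single flip: single_add)

text \<open>Every monomial of a product is a monomial of one factor times a monomial of the other,
  and a sum has no monomials beyond those of its summands. A divisibility-closed \<open>P\<close>
  therefore survives both operations.\<close>

lemma ideal_monomials: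
  fixes P :: "('v \<Rightarrow>\<^sub>0 nat) \<Rightarrow> bool"
  assumes "\<And>m n. P m \<Longrightarrow> P (m + n)"
  shows "ideal {f. \<forall>m\<in>Poly_Mapping.keys f. P m} (poly_ring :: ('v, 'k::field) mpoly ring)"
proof -
  interpret ring "poly_ring :: ('v, 'k) mpoly ring" by (rule ring_poly_ring)
  let ?I = "{f :: ('v, 'k) mpoly. \<forall>m\<in>Poly_Mapping.keys f. P m}"
  have mult: "x * y \<in> ?I" if "x \<in> ?I" for x y
    using that keys_mult[of x y] assms by fastforce
  show ?thesis
  proof (rule idealI)
    show "subgroup ?I (add_monoid poly_ring)"
    proof (rule add.subgroupI)
      show "\<ominus>\<^bsub>poly_ring\<^esub> x \<in> ?I" if "x \<in> ?I" for x
        using that unfolding a_inv_poly_ring by simp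
      show "x \<oplus>\<^bsub>poly_ring\<^esub> y \<in> ?I" if "x \<in> ?I" "y \<in> ?I" for x y
        using that keys_add[of x y] by auto
    next
      show "?I \<noteq> {}"
        by (auto intro!: exI[of _ 0])
    qed auto
    show "x \<otimes>\<^bsub>poly_ring\<^esub> a \<in> ?I" if "a \<in> ?I" for a x
      using mult[OF that, of x] by (simp add: mult.commute)
    show "a \<otimes>\<^bsub>poly_ring\<^esub> x \<in> ?I" if "a \<in> ?I" for a x
      using mult[OF that, of x] by simp
  qed (rule ring_poly_ring)
qed

text \<open>The monomials that become zero in \<open>A\<close>: a nonface support means divisibility
  by a squarefree generator, a large exponent means divisibility by some
  \<open>var i ^ a i\<close>.\<close>

definition vanishing_monomial :: "'v set set \<Rightarrow> ('v \<Rightarrow> nat) \<Rightarrow> ('v \<Rightarrow>\<^sub>0 nat) \<Rightarrow> bool" where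
  "vanishing_monomial \<Delta> a m \<longleftrightarrow>
     Poly_Mapping.keys m \<notin> \<Delta> \<or> (\<exists>i. a i \<le> Poly_Mapping.lookup m i)"

lemma keys_add_nat:
  "Poly_Mapping.keys (m + n) = Poly_Mapping.keys m \<union> Poly_Mapping.keys (n :: 'v \<Rightarrow>\<^sub>0 nat)"
  by (auto simp: in_keys_iff lookup_add)

lemma vanishing_monomial_add:
  assumes "simplicial_complex \<Delta>" "vanishing_monomial \<Delta> a m"
  shows "vanishing_monomial \<Delta> a (m + n)"
  using assms unfolding vanishing_monomial_def simplicial_complex_def
  by (metis Un_upper1 keys_add_nat le_add1 lookup_add order_trans)

text \<open>The right-hand side is an ideal containing all generators, which gives one inclusion.
  Conversely, each vanishing monomial is a multiple of a generator, and a polynomial is the sum of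
  its terms.\<close>

lemma artinian_ideal_eq:
  fixes \<Delta> :: "'v::finite set set"
  assumes sc: "simplicial_complex \<Delta>"
  shows "(artinian_ideal \<Delta> a :: ('v, 'k::field) mpoly set) =
    {f. \<forall>m\<in>Poly_Mapping.keys f. vanishing_monomial \<Delta> a m}" (is "?I = ?J")
    and "ideal (artinian_ideal \<Delta> a) (poly_ring :: ('v, 'k::field) mpoly ring)"
proof -
  interpret ring "poly_ring :: ('v, 'k) mpoly ring" by (rule ring_poly_ring)
  let ?S = "stanley_reisner_ideal \<Delta> :: ('v, 'k) mpoly set"
  let ?P = "{var i ^ a i |i. True} :: ('v, 'k) mpoly set"
  let ?G = "{\<Prod>i\<in>S. var i |S. S \<notin> \<Delta>} :: ('v, 'k) mpoly set"
  have J: "ideal ?J poly_ring"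
    by (rule ideal_monomials) (rule vanishing_monomial_add[OF sc])
  have keys_sum_single:
    "Poly_Mapping.keys (\<Sum>i\<in>S. Poly_Mapping.single i (1::nat)) = S" for S :: "'v set"
    by (rule Set.set_eqI) (simp add: in_keys_iff lookup_sum lookup_single when_def)
  have "?S \<subseteq> ?J" unfolding stanley_reisner_ideal_def
    by (rule genideal_minimal[OF J])
      (auto simp: prod_var vanishing_monomial_def keys_sum_single simp del: One_nat_def split: if_splits)
  moreover have "Idl\<^bsub>poly_ring\<^esub> ?P \<subseteq> ?J"
  proof (rule genideal_minimal[OF J])
    have "vanishing_monomial \<Delta> a (Poly_Mapping.single i (a i))" for i
      unfolding vanishing_monomial_def by (rule disjI2) (rule exI[of _ i], simp)
    then show "?P \<subseteq> ?J" by (auto simp: var_power)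
  qed
  ultimately have "g + h \<in> ?J" if "g \<in> ?S" "h \<in> Idl\<^bsub>poly_ring\<^esub> ?P" for g h
    using additive_subgroup.a_closed[OF ideal.axioms(1)[OF J], of g h] that
    unfolding poly_ring_simps by blast
  then have IJ: "?I \<subseteq> ?J"
    unfolding artinian_ideal_def set_add_def' poly_ring_simps by blast
  have S: "ideal ?S poly_ring" unfolding stanley_reisner_ideal_def
    by (rule genideal_ideal) auto
  have P: "ideal (Idl\<^bsub>poly_ring\<^esub> ?P) poly_ring"
    by (rule genideal_ideal) auto
  have I: "ideal ?I poly_ring"
    unfolding artinian_ideal_def by (rule add_ideals[OF S P])
  interpret I: ideal ?I poly_ring by (rule I)
  have zero: "0 \<in> ?S" "0 \<in> Idl\<^bsub>poly_ring\<^esub> ?P"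
    using additive_subgroup.zero_closed[OF ideal.axioms(1)[OF S]]
      additive_subgroup.zero_closed[OF ideal.axioms(1)[OF P]] unfolding poly_ring_simps by blast+
  have SI: "?S \<subseteq> ?I" and PI: "Idl\<^bsub>poly_ring\<^esub> ?P \<subseteq> ?I"
  proof -
    show "?S \<subseteq> ?I"
    proof
      fix f assume "f \<in> ?S"
      then have "f + 0 \<in> ?I"
        using zero(2) unfolding artinian_ideal_def set_add_def' poly_ring_simps by blast
      then show "f \<in> ?I" by simp
    qed
    show "Idl\<^bsub>poly_ring\<^esub> ?P \<subseteq> ?I"
    proof
      fix f assume "f \<in> Idl\<^bsub>poly_ring\<^esub> ?P"
      then have "0 + f \<in> ?I"
        using zero(1) unfolding artinian_ideal_def set_add_def' poly_ring_simps by blast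
      then show "f \<in> ?I" by simp
    qed
  qed
  have gen: "?G \<subseteq> ?I" "?P \<subseteq> ?I"
    using SI PI genideal_self[of ?G] genideal_self[of ?P]
    unfolding stanley_reisner_ideal_def by auto
  \<comment> \<open>Divisibility of monomials is the pointwise order on exponents; under it the
    truncated difference \<open>m - n\<close> is the exponent of the true cofactor.\<close>
  have multiple: "Poly_Mapping.single m c \<in> ?I"
    if "Poly_Mapping.single n 1 \<in> ?I"
      "\<And>i. Poly_Mapping.lookup n i \<le> Poly_Mapping.lookup m i" for m n c
  proof -
    have "m = (m - n) + n"
      by (rule poly_mapping_eqI) (simp add: lookup_add lookup_minus that(2))
    then have "Poly_Mapping.single m c =
        Poly_Mapping.single (m - n) c * Poly_Mapping.single n 1"
      by (simp add: mult_single)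
    then show ?thesis
      using I.I_l_closed[OF that(1)] by simp
  qed
  have single: "Poly_Mapping.single m c \<in> ?I" if "vanishing_monomial \<Delta> a m" for m c
    using that unfolding vanishing_monomial_def
  proof
    assume "Poly_Mapping.keys m \<notin> \<Delta>"
    then have "(\<Prod>i\<in>Poly_Mapping.keys m. var i) \<in> ?I"
      using gen(1) by blast
    then have "Poly_Mapping.single (\<Sum>i\<in>Poly_Mapping.keys m. Poly_Mapping.single i 1) 1 \<in> ?I"
      by (simp only: prod_var finite_keys)
    then show ?thesis
      by (rule multiple) (simp add: lookup_sum lookup_single when_def in_keys_iff)
  next
    assume "\<exists>i. a i \<le> Poly_Mapping.lookup m i"
    then obtain i where i: "a i \<le> Poly_Mapping.lookup m i" by blast
    have "var i ^ a i \<in> ?I"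
      using gen(2) by blast
    then have "Poly_Mapping.single (Poly_Mapping.single i (a i)) 1 \<in> ?I"
      by (simp only: var_power)
    then show ?thesis
      by (rule multiple) (use i in \<open>auto simp: lookup_single when_def\<close>)
  qed
  have "?J \<subseteq> ?I"
  proof
    fix f assume "f \<in> ?J"
    then have terms: "Poly_Mapping.single m (Poly_Mapping.lookup f m) \<in> ?I"
      if "m \<in> Poly_Mapping.keys f" for m
      using that single by blast
    have "(\<Sum>m\<in>M. Poly_Mapping.single m (Poly_Mapping.lookup f m)) \<in> ?I"
      if "finite M" "M \<subseteq> Poly_Mapping.keys f" for M
      using that
    proof (induction M rule: finite_induct)
      case empty
      then show ?case using I.zero_closed by simp
    next
      case (insert m M)
      then show ?case using I.a_closed[OF terms] by simp
    qed
    from this[OF finite_keys order_refl] show "f \<in> ?I"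
      unfolding poly_mapping_sum_single[symmetric] .
  qed
  with IJ show "?I = ?J" by blast
  show "ideal (artinian_ideal \<Delta> a) (poly_ring :: ('v, 'k) mpoly ring)"
    by (rule I)
qed

section \<open>Levelness from facet weights\<close>

text \<open>\<open>dim\<close> is a definite description, so uniqueness has to be shown. In a
  positive-dimensional presentation of the zero space the last vector \<open>v\<close> lies in that
  space, hence is zero, yet it must avoid a subspace that contains zero. Asking only for 0 and 1 in
  \<open>K\<close> spares a proof that the scalars form a subfield.\<close>

lemma (in ring) dim_zero:
  assumes "\<zero> \<in> K" "\<one> \<in> K"
  shows "dim K {\<zero>} = 0"
proof -
  have zero_mem: "\<zero> \<in> E" if "dimension n K E" "\<zero> \<in> K" for n E
    using that
  proof (induction rule: dimension.induct)
    case (Suc_dim v E n)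
    then show ?case
      unfolding line_extension_mem_iff
      by (intro bexI[of _ \<zero>]) simp_all
  qed simp
  have "n = 0" if "dimension n K {\<zero>}" for n
    using that
  proof (cases rule: dimension.cases)
    case (Suc_dim v E n)
    have "v \<in> line_extension K v E"
      unfolding line_extension_mem_iff
      by (intro bexI[of _ \<one>] bexI[of _ \<zero>])
        (use Suc_dim assms zero_mem in simp_all)
    then have "v = \<zero>"
      using Suc_dim(2) by blast
    then show ?thesis
      using Suc_dim(4,5) zero_mem[OF _ assms(1)] by blast
  qed
  then show ?thesis
    unfolding over_def dim_def by (intro the_equality) auto
qed

lemma subset_facet:
  fixes \<Delta> :: "'v::finite set set"
  assumes "F \<in> \<Delta>"
  obtains G where "G \<in> facets \<Delta>" "F \<subseteq> G"
proof -
  have "finite \<Delta>" by simp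
  from finite_has_maximal2[OF this assms] obtain G where
    "G \<in> \<Delta>" "F \<subseteq> G" "\<forall>H\<in>\<Delta>. G \<subseteq> H \<longrightarrow> G = H" by blast
  then have "G \<in> facets \<Delta>"
    unfolding facets_def by blast
  with \<open>F \<subseteq> G\<close> show thesis
    by (rule that[rotated])
qed

section \<open>Socle monomials and the level property\<close>

lemma sum_lookup_eq_sum_keys:
  "(\<Sum>i\<in>UNIV. Poly_Mapping.lookup m i) =
    (\<Sum>i\<in>Poly_Mapping.keys m. Poly_Mapping.lookup (m :: 'v::finite \<Rightarrow>\<^sub>0 nat) i)"
  by (rule sum.mono_neutral_right) (auto simp: in_keys_iff)

text \<open>Multiplying by a variable of the support keeps the support, so only the exponent bound
  at that variable can make the product vanish. Multiplying by a new variable gives it exponent 1,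
  below the bound, so the product vanishes only if the enlarged support is a nonface.\<close>

lemma vanishing_monomial_neighbours:
  fixes \<Delta> :: "'v::finite set set"
  assumes sc: "simplicial_complex \<Delta>" and a2: "\<And>i. a i \<ge> 2"
    and nz: "\<not> vanishing_monomial \<Delta> a m"
    and killed: "\<And>i. vanishing_monomial \<Delta> a (m + Poly_Mapping.single i 1)"
  shows "Poly_Mapping.keys m \<in> facets \<Delta>"
    and "i \<in> Poly_Mapping.keys m \<Longrightarrow> Poly_Mapping.lookup m i = a i - 1"
proof -
  have face: "Poly_Mapping.keys m \<in> \<Delta>" and lt: "\<And>i. Poly_Mapping.lookup m i < a i"
    using nz by (auto simp: vanishing_monomial_def not_le)
  \<comment> \<open>If the enlarged support is still a face, the product must vanish through some
    exponent bound.\<close>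
  have attained: "\<exists>j. a j \<le> Poly_Mapping.lookup m j + (if i = j then 1 else 0)"
    if "insert i (Poly_Mapping.keys m) \<in> \<Delta>" for i
    using killed[of i] that
    by (simp add: vanishing_monomial_def keys_add_nat lookup_add lookup_single when_def
        split del: if_split del: One_nat_def)
  show "Poly_Mapping.lookup m i = a i - 1" if "i \<in> Poly_Mapping.keys m" for i
  proof -
    have "insert i (Poly_Mapping.keys m) \<in> \<Delta>"
      using that face by (simp add: insert_absorb)
    from attained[OF this] obtain j
      where "a j \<le> Poly_Mapping.lookup m j + (if i = j then 1 else 0)" by blast
    then show ?thesis
      using lt[of j] by (auto split: if_splits)
  qed
  have "i \<in> Poly_Mapping.keys m" if "insert i (Poly_Mapping.keys m) \<in> \<Delta>" for i
  proof (rule ccontr)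
    assume "i \<notin> Poly_Mapping.keys m"
    then have "Poly_Mapping.lookup m i = 0"
      by (simp add: in_keys_iff)
    moreover from attained[OF that] obtain j
      where "a j \<le> Poly_Mapping.lookup m j + (if i = j then 1 else 0)" by blast
    \<comment> \<open>By \<open>lt\<close> the bound can only be reached at \<open>j = i\<close>,
      where the exponent is now 1; this contradicts \<open>a i \<ge> 2\<close>.\<close>
    ultimately show False
      using lt[of j] a2[of j] by (auto split: if_splits)
  qed
  then have "G = Poly_Mapping.keys m" if "G \<in> \<Delta>" "Poly_Mapping.keys m \<subseteq> G" for G
    using that sc unfolding simplicial_complex_def by (metis insert_subset subsetI subset_antisym)
  then show "Poly_Mapping.keys m \<in> facets \<Delta>"
    using face by (auto simp: facets_def)
qed

text \<open>If a homogeneous \<open>f\<close> represents a socle element, each of its nonvanishing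
  monomials is killed by all variables, hence has the weight \<open>s\<close> of a facet as its
  degree. So the socle is zero in every other degree, and it remains to see that \<open>s\<close> is
  the top degree of \<open>A\<close>.\<close>

lemma level_artinian_ideal:
  fixes \<Delta> :: "'v::finite set set"
  assumes sc: "simplicial_complex \<Delta>" and a2: "\<And>i. a i \<ge> 2"
    and weight: "\<And>F. F \<in> facets \<Delta> \<Longrightarrow> (\<Sum>i\<in>F. a i - 1) = s"
  shows "level (artinian_ideal \<Delta> a :: ('v, 'k::field) mpoly set)"
proof -
  define I where "I = (artinian_ideal \<Delta> a :: ('v, 'k) mpoly set)"
  have I_eq: "I = {f. \<forall>m\<in>Poly_Mapping.keys f. vanishing_monomial \<Delta> a m}"
    and ideal_I: "ideal I poly_ring"
    unfolding I_def using artinian_ideal_eq[OF sc] by blast+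
  interpret R: ring "poly_ring :: ('v, 'k) mpoly ring" by (rule ring_poly_ring)
  interpret I: ideal I poly_ring by (rule ideal_I)
  interpret A: ring "quotient_algebra I"
    unfolding quotient_algebra_def by (rule I.quotient_is_ring)
  have zero: "\<zero>\<^bsub>quotient_algebra I\<^esub> = I" and one: "\<one>\<^bsub>quotient_algebra I\<^esub> = residue_class I 1"
    by (simp_all add: quotient_algebra_def FactRing_def residue_class_def)
  have carr: "residue_class I f \<in> carrier (quotient_algebra I)" for f
    using R.a_rcosetsI[OF I.a_subset, of f]
    by (simp add: quotient_algebra_def FactRing_def residue_class_def)
  have class_zero: "residue_class I f = I \<longleftrightarrow> f \<in> I" for f
    using I.a_rcos_self[of f] I.a_rcos_const[of f] by (auto simp: residue_class_def)
  have class_mult: "residue_class I f \<otimes>\<^bsub>quotient_algebra I\<^esub> residue_class I g =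
      residue_class I (f * g)" for f g
    using I.rcoset_mult_add[of f g]
    by (simp add: quotient_algebra_def FactRing_def residue_class_def)
  have zero_graded: "I \<in> graded_part I d" for d
    unfolding graded_part_def using class_zero[of 0] I.zero_closed
    by (auto simp: homogeneous_polys_def intro!: image_eqI[of _ _ 0])
  have graded_zero: "graded_part I d = {I} \<longleftrightarrow> homogeneous_polys d \<subseteq> I" for d
    using zero_graded[of d] class_zero by (auto simp: graded_part_def)

  \<comment> \<open>The support lies in some facet \<open>F\<close>, and each exponent is at most
    \<open>a i - 1\<close>.\<close>
  have degree_le: "(\<Sum>i\<in>UNIV. Poly_Mapping.lookup m i) \<le> s"
    if nz: "\<not> vanishing_monomial \<Delta> a m" for m
  proof -
    have "Poly_Mapping.keys m \<in> \<Delta>" and lt: "\<And>i. Poly_Mapping.lookup m i < a i"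
      using nz by (auto simp: vanishing_monomial_def not_le)
    from subset_facet[OF this(1)] obtain F where F: "F \<in> facets \<Delta>" "Poly_Mapping.keys m \<subseteq> F" .
    have "(\<Sum>i\<in>UNIV. Poly_Mapping.lookup m i) = (\<Sum>i\<in>F. Poly_Mapping.lookup m i)"
      using F(2) by (intro sum.mono_neutral_right) (auto simp: in_keys_iff)
    also have "\<dots> \<le> (\<Sum>i\<in>F. a i - 1)"
      using lt by (intro sum_mono) (metis Suc_pred' less_Suc_eq_le neq0_conv not_less0)
    finally show ?thesis using weight[OF F(1)] by simp
  qed
  have top: "\<not> homogeneous_polys s \<subseteq> I"
  proof -
    have "{} \<in> \<Delta>"
      using sc unfolding simplicial_complex_def by (metis empty_subsetI)
    from subset_facet[OF this] obtain F where F: "F \<in> facets \<Delta>" by blast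
    \<comment> \<open>The largest nonvanishing monomial supported on \<open>F\<close>; its degree is
      the weight \<open>s\<close>. Since \<open>a i - 1 > 0\<close>, its support is all of
      \<open>F\<close>.\<close>
    define m where "m = (\<Sum>i\<in>F. Poly_Mapping.single i (a i - 1))"
    have lookup_m: "Poly_Mapping.lookup m i = (if i \<in> F then a i - 1 else 0)" for i
      by (simp add: m_def lookup_sum lookup_single when_def)
    have pos: "a i - 1 > 0" "a i > 0" "a i - 1 < a i" for i
      using a2[of i] by auto
    have "Poly_Mapping.keys m = F"
      using pos by (intro Set.set_eqI) (simp add: in_keys_iff lookup_m)
    then have "\<not> vanishing_monomial \<Delta> a m"
      using F pos(2,3) by (auto simp: vanishing_monomial_def lookup_m facets_def not_le simp del: diff_is_0_eq)
    then have "Poly_Mapping.single m 1 \<notin> I"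
      by (simp add: I_eq)
    moreover have "Poly_Mapping.single m 1 \<in> homogeneous_polys s"
      using weight[OF F] by (simp add: homogeneous_polys_def lookup_m sum.If_cases)
    ultimately show ?thesis by blast
  qed
  have degree: "socle_degree I = s"
    unfolding socle_degree_def
  proof (rule Max_eqI)
    \<comment> \<open>A homogeneous polynomial outside the ideal contains a nonvanishing monomial of
      the same degree, to which \<open>degree_le\<close> applies.\<close>
    have bound: "d \<le> s" if "\<not> homogeneous_polys d \<subseteq> I" for d
      using that degree_le by (fastforce simp: I_eq homogeneous_polys_def)
    then show "d \<le> s" if "d \<in> {d. graded_part I d \<noteq> {\<zero>\<^bsub>quotient_algebra I\<^esub>}}" for d
      using that by (simp add: zero graded_zero)
    then show "finite {d. graded_part I d \<noteq> {\<zero>\<^bsub>quotient_algebra I\<^esub>}}"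
      by (meson finite_nat_set_iff_bounded_le)
    show "s \<in> {d. graded_part I d \<noteq> {\<zero>\<^bsub>quotient_algebra I\<^esub>}}"
      using top by (simp add: zero graded_zero)
  qed

  have "socle I \<inter> graded_part I d = {I}" if "d \<noteq> s" for d
  proof
    show "socle I \<inter> graded_part I d \<subseteq> {I}"
    proof
      fix c assume c: "c \<in> socle I \<inter> graded_part I d"
      then obtain f where f: "f \<in> homogeneous_polys d" "c = residue_class I f"
        by (auto simp: graded_part_def)
      have fI: "f * var i \<in> I" for i
        using c by (simp add: socle_def f(2) class_mult zero class_zero)
      have "vanishing_monomial \<Delta> a m" if m: "m \<in> Poly_Mapping.keys f" for m
      proof (rule ccontr)
        assume nz: "\<not> vanishing_monomial \<Delta> a m"
        have "m + Poly_Mapping.single i 1 \<in> Poly_Mapping.keys (f * var i)" for i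
          using m by (simp add: in_keys_iff var_def lookup_times_single)
        then have killed: "vanishing_monomial \<Delta> a (m + Poly_Mapping.single i 1)" for i
          using fI by (auto simp: I_eq)
        note socle = vanishing_monomial_neighbours[OF sc a2 nz killed]
        have "d = (\<Sum>i\<in>Poly_Mapping.keys m. Poly_Mapping.lookup m i)"
          using f(1) m by (simp add: homogeneous_polys_def sum_lookup_eq_sum_keys)
        also have "\<dots> = s"
          using socle weight by (metis (no_types, lifting) sum.cong)
        finally show False using \<open>d \<noteq> s\<close> by simp
      qed
      then show "c \<in> {I}"
        by (simp add: f(2) class_zero) (simp add: I_eq)
    qed
    have "I \<in> socle I"
      using A.zero_closed A.l_null[OF carr] unfolding socle_def zero by blast
    then show "{I} \<subseteq> socle I \<inter> graded_part I d"
      using zero_graded by simp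
  qed
  moreover have "ring.dim (quotient_algebra I) (scalars I) {\<zero>\<^bsub>quotient_algebra I\<^esub>} = 0"
  proof (rule A.dim_zero)
    show "\<zero>\<^bsub>quotient_algebra I\<^esub> \<in> scalars I"
    proof -
      have "residue_class I (const 0) = I"
        using class_zero[of 0] I.zero_closed by (simp add: const_def)
      then show ?thesis
        unfolding zero scalars_def by (metis rangeI image_eqI)
    qed
    show "\<one>\<^bsub>quotient_algebra I\<^esub> \<in> scalars I"
    proof -
      have "(const 1 :: ('v, 'k) mpoly) = 1"
        by (simp add: const_def)
      then show ?thesis
        unfolding one scalars_def by (metis rangeI image_eqI)
    qed
  qed
  ultimately show ?thesis
    unfolding I_def[symmetric] level_def socle_vector_def by (simp add: degree zero)
qed

text \<open>With \<open>a i = b i + 1\<close>, positivity of the weights is exactly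
  \<open>a i \<ge> 2\<close>.\<close>

lemma levelableI:
  fixes \<Delta> :: "'v::finite set set" and b :: "'v \<Rightarrow> nat"
  assumes "simplicial_complex \<Delta>" and "\<And>i. b i > 0"
    and "\<And>F. F \<in> facets \<Delta> \<Longrightarrow> (\<Sum>i\<in>F. b i) = s"
  shows "levelable TYPE('k::field) \<Delta>"
  unfolding levelable_def
proof (intro exI conjI allI)
  show "level (artinian_ideal \<Delta> (\<lambda>i. b i + 1) :: ('v, 'k) mpoly set)"
    using assms by (intro level_artinian_ideal[where s = s]) (auto simp: Suc_le_eq)
qed (use assms(2) in \<open>auto simp: Suc_le_eq\<close>)

section \<open>Weights\<close>

lemma levelable_pure:
  fixes \<Delta> :: "'v::finite set set"
  assumes "simplicial_complex \<Delta>" "pure \<Delta>"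
  shows "levelable TYPE('k::field) \<Delta>"
proof -
  obtain F where "F \<in> facets \<Delta>"
    using subset_facet assms(1) unfolding simplicial_complex_def by metis
  then have "card G = card F" if "G \<in> facets \<Delta>" for G
    using that assms(2) unfolding pure_def by blast
  then show ?thesis
    by (intro levelableI[where b = "\<lambda>_. 1" and s = "card F"] assms(1)) simp_all
qed

text \<open>Each vertex lies in some facet, and disjointness makes it unique; so the weight of a
  vertex may be defined from its facet \<open>F i\<close>.\<close>

lemma levelable_disjoint:
  fixes \<Delta> :: "'v::finite set set"
  assumes sc: "simplicial_complex \<Delta>"
    and disj: "\<forall>F\<in>facets \<Delta>. \<forall>G\<in>facets \<Delta>. F \<noteq> G \<longrightarrow> F \<inter> G = {}"
  shows "levelable TYPE('k::field) \<Delta>"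
proof -
  have "\<exists>F. F \<in> facets \<Delta> \<and> i \<in> F" for i
  proof -
    have "{i} \<in> \<Delta>"
      using sc by (simp add: simplicial_complex_def)
    then obtain F where "F \<in> facets \<Delta>" "{i} \<subseteq> F"
      by (rule subset_facet)
    then show ?thesis by blast
  qed
  then obtain F where "\<forall>i. F i \<in> facets \<Delta> \<and> i \<in> F i"
    using choice[of "\<lambda>i F. F \<in> facets \<Delta> \<and> i \<in> F"] by blast
  then have F: "F i \<in> facets \<Delta>" "i \<in> F i" for i
    by simp_all
  have facet_eq: "F i = G" if "G \<in> facets \<Delta>" "i \<in> G" for i G
  proof -
    have "F i \<inter> G \<noteq> {}" using that(2) F(2)[of i] by blast
    then show ?thesis using disj F(1)[of i] that(1) by metis
  qed
  have card: "0 < card (F i)" "card (F i) dvd fact (CARD('v))" for i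
  proof -
    show "0 < card (F i)"
      using F(2)[of i] by (auto simp: card_gt_0_iff)
    then show "card (F i) dvd fact (CARD('v))"
      by (intro dvd_fact) (simp_all add: Suc_le_eq card_mono)
  qed
  \<comment> \<open>The factorial of the number of vertices is a common multiple of all facet
    cardinalities, so these quotients are exact.\<close>
  define b :: "'v \<Rightarrow> nat" where "b i = fact (CARD('v)) div card (F i)" for i
  show ?thesis
  proof (rule levelableI[OF sc])
    show "b i > 0" for i
      unfolding b_def using card[of i] by (simp add: div_greater_zero_iff dvd_imp_le)
    show "(\<Sum>i\<in>G. b i) = fact (CARD('v))" if G: "G \<in> facets \<Delta>" for G
    proof -
      \<comment> \<open>Writing \<open>G\<close> as some \<open>F v\<close> makes the divisibility
        in \<open>card\<close> available. The empty set lies below every face, so as a facet it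
        would equal \<open>F v\<close> for any vertex, such as \<open>undefined\<close>.\<close>
      obtain v :: 'v where "F v = G"
      proof (cases "G = {}")
        case True
        have "F undefined = {}"
          using G F(1)[of undefined] unfolding True facets_def by blast
        with True show thesis using that by blast
      next
        case False
        then obtain i where "i \<in> G" by blast
        from facet_eq[OF G this] show thesis by (rule that)
      qed
      have "(\<Sum>i\<in>G. b i) = (\<Sum>i\<in>G. fact (CARD('v)) div card G)"
        using facet_eq[OF G] by (intro sum.cong) (auto simp: b_def)
      also have "\<dots> = fact (CARD('v))"
        using card(2)[of v] \<open>F v = G\<close> by simp
      finally show ?thesis .
    qed
  qed
qed

text \<open>Let \<open>W\<close> be the set of vertices whose complement is a facet. A facet missing
  one vertex contains all of \<open>W\<close> except that vertex. A facet missing two contains all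
  of \<open>W\<close>, since otherwise it would lie strictly inside a larger facet. The lost vertex
  and the lost element of \<open>W\<close> balance: both kinds have weight
  \<open>CARD('v) + card W - 2\<close>.\<close>

lemma levelable_codimension_le_2:
  fixes \<Delta> :: "'v::finite set set"
  assumes sc: "simplicial_complex \<Delta>"
    and card: "\<And>F. F \<in> facets \<Delta> \<Longrightarrow> card F + 1 = CARD('v) \<or> card F + 2 = CARD('v)"
  shows "levelable TYPE('k::field) \<Delta>"
proof -
  define W where "W = {w. - {w} \<in> facets \<Delta>}"
  have "(\<Sum>i\<in>F. if i \<in> W then 2 else 1) = CARD('v) + card W - (2::nat)" if F: "F \<in> facets \<Delta>" for F
  proof -
    have "(\<Sum>i\<in>F. if i \<in> W then 2 else 1) = (\<Sum>i\<in>F. 1 + (if i \<in> W then 1 else (0::nat)))"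
      by (intro sum.cong) auto
    also have "\<dots> = card F + card (F \<inter> W)"
      by (simp only: sum.distrib) (simp add: sum.If_cases)
    finally have sum: "(\<Sum>i\<in>F. if i \<in> W then 2 else 1) = card F + card (F \<inter> W)" .
    show ?thesis
    proof (cases "card F + 1 = CARD('v)")
      case True
      then have "card (- F) = 1"
        by (simp add: Compl_eq_Diff_UNIV card_Diff_subset)
      then obtain w where "- F = {w}"
        by (auto simp: card_1_singleton_iff)
      then have w: "F = - {w}" by blast
      then have "w \<in> W" "F \<inter> W = W - {w}"
        using F by (auto simp: W_def)
      \<comment> \<open>Nonemptiness of \<open>W\<close> keeps the truncated subtractions
        exact.\<close>
      moreover from this have "card W > 0"
        by (auto simp: card_gt_0_iff)
      ultimately show ?thesis
        using True sum by (simp add: card_Diff_singleton)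
    next
      case False
      then have F2: "card F + 2 = CARD('v)"
        using card[OF F] by simp
      have "w \<in> F" if "w \<in> W" for w
      proof (rule ccontr)
        assume "w \<notin> F"
        then have "F = - {w}"
          using F that by (auto simp: W_def facets_def)
        then show False
          using F2 by (simp add: Compl_eq_Diff_UNIV card_Diff_subset)
      qed
      then have "F \<inter> W = W" by blast
      then show ?thesis
        using F2 sum by simp
    qed
  qed
  then show ?thesis
    by (rule levelableI[OF sc, rotated]) simp_all
qed

text \<open>If the full vertex set is a facet, it is the only one and the complex is pure. Otherwise
  facets are proper, nonempty and not points, so their size is between 2 and
  \<open>CARD('v) - 1\<close>; for at most four vertices that leaves only codimension 1 or
  2.\<close>

lemma levelable_le_4_vertices:
  fixes \<Delta> :: "'v::finite set set"
  assumes sc: "simplicial_complex \<Delta>" and no_point: "\<forall>F\<in>facets \<Delta>. card F \<noteq> 1"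
    and n: "CARD('v) \<le> 4"
  shows "levelable TYPE('k::field) \<Delta>"
proof (cases "UNIV \<in> facets \<Delta>")
  case True
  then have "pure \<Delta>"
    by (auto simp: pure_def facets_def)
  with sc show ?thesis by (rule levelable_pure)
next
  case False
  show ?thesis
  proof (rule levelable_codimension_le_2[OF sc])
    fix F assume F: "F \<in> facets \<Delta>"
    have "F \<noteq> {}"
      using F sc by (auto simp: facets_def simplicial_complex_def)
    then have "card F \<noteq> 0" by simp
    moreover have "card F \<noteq> 1"
      using no_point F by blast
    ultimately have "card F \<ge> 2" by linarith
    moreover have "card F < CARD('v)"
      using F False by (intro psubset_card_mono) auto
    ultimately show "card F + 1 = CARD('v) \<or> card F + 2 = CARD('v)"
      using n by linarith
  qed
qed

theorem theorem4p7:
  fixes \<Delta> :: "'v::finite set set"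
  assumes "simplicial_complex \<Delta>"
    and "\<forall>F\<in>facets \<Delta>. card F \<noteq> 1"
  shows "(pure \<Delta> \<longrightarrow> levelable TYPE('k::field_char_0) \<Delta>) \<and>
         (CARD('v) \<le> 4 \<longrightarrow> levelable TYPE('k) \<Delta>) \<and>
         ((\<forall>F\<in>facets \<Delta>. \<forall>G\<in>facets \<Delta>. F \<noteq> G \<longrightarrow> F \<inter> G = {}) \<longrightarrow> levelable TYPE('k) \<Delta>)"
  by (intro conjI impI levelable_pure[OF assms(1)] levelable_le_4_vertices[OF assms]
      levelable_disjoint[OF assms(1)])

end
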